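(* The monoid $\mathcal{M}_1$ is $2$-aligned, but not singly aligned.
   Context: $\mathcal{M}_1$ is the monoid with monoid presentation $\langle a,b,c,d,A_1,B_1,C_1,D_1 \mid da=A_1C_1,\ A_1D_1=db,\ cb=B_1D_1\rangle$ (generators are distinct letters). For a monoid $M$ and $p\in M$ write $pM=\{pm:m\in M\}$, and for $r_1,\dots,r_k\in M$ write $\{r_1,\dots,r_k\}M=r_1M\cup\dots\cup r_kM$. For a positive integer $k$, a left cancellative monoid $M$ (i.e. $xy=xz$ implies $y=z$) is called $k$-aligned if for all $p,q\in M$, either $pM\cap qM=\varnothing$ or $pM\cap qM=\{r_1,\dots,r_j\}M$ for some $1\le j\le k$ and some $r_1,\dots,r_j\in M$. Singly aligned means $1$-aligned. *)

theory Defs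
  imports "HOL-Algebra.Coset"
begin

subsection \<open>Monoid presentations\<close>

text \<open>
  The generators of a presentation are all the elements of the type of letters, and \<open>R\<close> is its
  set of defining relations. \<open>pres_cong R\<close> is the congruence on the free monoid of words that
  \<open>R\<close> generates.
\<close>

inductive_set pres_cong :: "('a list \<times> 'a list) set \<Rightarrow> ('a list \<times> 'a list) set"
  for R :: "('a list \<times> 'a list) set" where
  rel: "(u, v) \<in> R \<Longrightarrow> (u, v) \<in> pres_cong R"
| refl: "(u, u) \<in> pres_cong R"
| sym: "(u, v) \<in> pres_cong R \<Longrightarrow> (v, u) \<in> pres_cong R"
| trans: "(u, v) \<in> pres_cong R \<Longrightarrow> (v, w) \<in> pres_cong R \<Longrightarrow> (u, w) \<in> pres_cong R"
| append: "(u, v) \<in> pres_cong R \<Longrightarrow> (u', v') \<in> pres_cong R \<Longrightarrow> (u @ u', v @ v') \<in> pres_cong R"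

definition presented_monoid :: "('a list \<times> 'a list) set \<Rightarrow> 'a list set monoid" where
  "presented_monoid R =
    \<lparr>carrier = UNIV // pres_cong R,
     mult = (\<lambda>X Y. \<Union>x\<in>X. \<Union>y\<in>Y. pres_cong R `` {x @ y}),
     one = pres_cong R `` {[]}\<rparr>"

lemma equiv_pres_cong: "equiv UNIV (pres_cong R)"
  by (rule equivI)
    (auto intro!: refl_onI symI transI intro: pres_cong.refl pres_cong.sym pres_cong.trans)

lemma carrier_presented_monoid: "carrier (presented_monoid R) = UNIV // pres_cong R"
  by (simp add: presented_monoid_def)

lemma one_presented_monoid: "\<one>\<^bsub>presented_monoid R\<^esub> = pres_cong R `` {[]}"
  by (simp add: presented_monoid_def)

lemma mult_presented_monoid:
  "pres_cong R `` {u} \<otimes>\<^bsub>presented_monoid R\<^esub> pres_cong R `` {v} = pres_cong R `` {u @ v}"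
proof -
  have "congruent2 (pres_cong R) (pres_cong R) (\<lambda>x y. pres_cong R `` {x @ y})"
    by (auto intro!: congruent2I' equiv_class_eq[OF equiv_pres_cong] pres_cong.append)
  then show ?thesis
    by (simp add: presented_monoid_def UN_equiv_class2[OF equiv_pres_cong equiv_pres_cong])
qed

lemma monoid_presented_monoid: "monoid (presented_monoid R)"
  by (rule monoidI)
    (auto simp: carrier_presented_monoid one_presented_monoid mult_presented_monoid
      elim!: quotientE intro!: quotientI)


subsection \<open>Aligned monoids\<close>

locale left_cancellative_monoid = monoid M for M (structure) +
  assumes l_cancel:
    "\<lbrakk>x \<in> carrier M; y \<in> carrier M; z \<in> carrier M; x \<otimes> y = x \<otimes> z\<rbrakk> \<Longrightarrow> y = z"

text \<open>
  Here \<open>p <# carrier M\<close> is the principal right ideal $pM$, and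
  \<open>set rs <#> carrier M\<close> is $\{r_1, \dots, r_j\}M$ for \<open>rs = [r\<^sub>1, \<dots>, r\<^sub>j]\<close>.
  Being aligned includes being left cancellative.
\<close>

definition k_aligned :: "nat \<Rightarrow> ('a, 'b) monoid_scheme \<Rightarrow> bool" where
  "k_aligned k M \<longleftrightarrow>
    left_cancellative_monoid M \<and>
    (\<forall>p\<in>carrier M. \<forall>q\<in>carrier M.
      (p <#\<^bsub>M\<^esub> carrier M) \<inter> (q <#\<^bsub>M\<^esub> carrier M) = {} \<or>
      (\<exists>rs. 1 \<le> length rs \<and> length rs \<le> k \<and> set rs \<subseteq> carrier M \<and>
        (p <#\<^bsub>M\<^esub> carrier M) \<inter> (q <#\<^bsub>M\<^esub> carrier M) = set rs <#>\<^bsub>M\<^esub> carrier M))"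

abbreviation singly_aligned :: "('a, 'b) monoid_scheme \<Rightarrow> bool" where
  "singly_aligned \<equiv> k_aligned 1"


subsection \<open>The monoid \<open>\<M>\<^sub>1\<close>\<close>

text \<open>The lower-case letters $a, b, c, d$ are written \<open>la\<close>, \<open>lb\<close>, \<open>lc\<close>, \<open>ld\<close>.\<close>

datatype letter = la | lb | lc | ld | A1 | B1 | C1 | D1

definition monoid_M1 :: "letter list set monoid" where
  "monoid_M1 = presented_monoid
    {([ld, la], [A1, C1]),
     ([A1, D1], [ld, lb]),
     ([lc, lb], [B1, D1])}"

end

theory Submission
  imports Defs
begin

text \<open>
  Read the relations as the rewriting rules \<open>da \<rightarrow> A\<^sub>1C\<^sub>1\<close>, \<open>A\<^sub>1D\<^sub>1 \<rightarrow> db\<close>, \<open>cb \<rightarrow> B\<^sub>1D\<^sub>1\<close>. The first letters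
  \<open>d, A\<^sub>1, c\<close> of the left-hand sides are not among their last letters \<open>a, D\<^sub>1, b\<close>, so redexes do not
  overlap; and no right-hand side begins with one of \<open>a, D\<^sub>1, b\<close> or ends with one of \<open>d, A\<^sub>1, c\<close>, so
  rewriting creates no new redex. Hence every word has a unique normal form, of the same length, and
  multiplying a normal form by a letter from the left changes nothing beyond its first letter. This
  left action of a letter (\<open>act\<close>) is injective on words, which gives left cancellation
  (\<open>nf_left_cancel\<close>).

  For alignment, take two elements with normal forms \<open>p\<close> and \<open>q\<close>. By cancellation the longest common
  prefix may be removed. If one of the words becomes empty, one of the two ideals contains the other.
  Otherwise they begin with distinct letters, and an equation \<open>xm = ym'\<close> with \<open>x \<noteq> y\<close> comes from one
  of the three relations (\<open>act_eq_act_cases\<close>). The pair \<open>{c, B\<^sub>1}\<close> occurs in only one of them, but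
  \<open>{d, A\<^sub>1}\<close> occurs in two: the ideals of \<open>d\<close> and \<open>A\<^sub>1\<close> meet in the union of the ideals of
  \<open>da = A\<^sub>1C\<^sub>1\<close> and \<open>db = A\<^sub>1D\<^sub>1\<close>. If \<open>p\<close> or \<open>q\<close> has more than one letter, its second
  letter decides which relation applies, and then the intersection is empty or is one of the two ideals.
  So two generators always suffice, while \<open>d\<close> and \<open>A\<^sub>1\<close> need two: a single generator
  would have length at least 2 and divide both \<open>A\<^sub>1C\<^sub>1\<close> and \<open>db\<close>, which have length 2 and are distinct.
\<close>

section \<open>Normal forms\<close>

definition M1_rels :: "(letter list \<times> letter list) set" where
  "M1_rels = {([ld, la], [A1, C1]), ([A1, D1], [ld, lb]), ([lc, lb], [B1, D1])}"

text \<open>Left multiplication of a normal form by a letter: the only possible redex is at the front, and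
  contracting it gives a normal form.\<close>

fun act :: "letter \<Rightarrow> letter list \<Rightarrow> letter list" where
  "act ld (la # n) = A1 # C1 # n"
| "act A1 (D1 # n) = ld # lb # n"
| "act lc (lb # n) = B1 # D1 # n"
| "act x n = x # n"

abbreviation nf :: "letter list \<Rightarrow> letter list" where
  "nf w \<equiv> foldr act w []"

lemma act_eq_if:
  "act x n =
    (if x = ld \<and> n \<noteq> [] \<and> hd n = la then A1 # C1 # tl n
     else if x = A1 \<and> n \<noteq> [] \<and> hd n = D1 then ld # lb # tl n
     else if x = lc \<and> n \<noteq> [] \<and> hd n = lb then B1 # D1 # tl n
     else x # n)"
  by (cases "(x, n)" rule: act.cases) auto

lemma act_inject [simp]: "act x m = act x n \<longleftrightarrow> m = n"
  by (auto simp: act_eq_if neq_Nil_conv split: if_splits)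

lemma length_act [simp]: "length (act x n) = Suc (length n)"
  by (auto simp: act_eq_if neq_Nil_conv)

lemma length_nf [simp]: "length (nf w) = length w"
  by (induction w) auto

lemma nf_left_cancel: "nf (u @ v) = nf (u @ w) \<longleftrightarrow> nf v = nf w"
  by (induction u) auto

text \<open>The two words of a relation act alike on every word, reduced or not, so the action passes to
  the presented monoid.\<close>

lemma foldr_act_cong:
  assumes "(u, v) \<in> pres_cong M1_rels"
  shows "foldr act u n = foldr act v n"
  using assms
  by (induction arbitrary: n rule: pres_cong.induct) (auto simp: M1_rels_def)

lemma act_pres_cong: "(x # n, act x n) \<in> pres_cong M1_rels"
proof -
  have step: "(u @ n', v @ n') \<in> pres_cong M1_rels" if "(u, v) \<in> M1_rels" for u v n'
    using that by (intro pres_cong.append pres_cong.rel pres_cong.refl)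
  show ?thesis
    using step[of "[ld, la]" "[A1, C1]" "tl n"] step[of "[A1, D1]" "[ld, lb]" "tl n"]
      step[of "[lc, lb]" "[B1, D1]" "tl n"]
    by (auto simp: act_eq_if M1_rels_def neq_Nil_conv pres_cong.refl)
qed

lemma nf_pres_cong: "(w, nf w) \<in> pres_cong M1_rels"
proof (induction w)
  case (Cons x w)
  have "([x] @ w, [x] @ nf w) \<in> pres_cong M1_rels"
    by (intro pres_cong.append pres_cong.refl Cons.IH)
  with act_pres_cong[of x "nf w"] show ?case
    by (auto intro: pres_cong.trans)
qed (simp add: pres_cong.refl)

lemma pres_cong_iff_nf_eq: "(u, v) \<in> pres_cong M1_rels \<longleftrightarrow> nf u = nf v"
  using foldr_act_cong nf_pres_cong by (metis pres_cong.sym pres_cong.trans)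

lemma nf_idem [simp]: "nf (nf w) = nf w"
  using nf_pres_cong pres_cong_iff_nf_eq by metis

lemma nf_eq_ConsD:
  assumes "nf (x # w) = x # w"
  shows "nf w = w"
  using assms by (auto simp: act_eq_if split: if_splits)

text \<open>A normal form cannot begin with \<open>a\<close>, \<open>b\<close>, \<open>C\<^sub>1\<close> or \<open>D\<^sub>1\<close> as a result of rewriting,
  because the right-hand sides begin with \<open>A\<^sub>1\<close>, \<open>d\<close> and \<open>B\<^sub>1\<close>.\<close>

lemma act_eq_Cons_second_letter:
  assumes "y \<in> {la, lb, C1, D1}"
  shows "act x m = y # n \<longleftrightarrow> x = y \<and> m = n"
  using assms by (auto simp: act_eq_if split: if_splits)

text \<open>If neither product is rewritten, or both are, the results begin with distinct letters. So exactly
  one is rewritten, and the equation is an instance of the relation that rewrites it.\<close>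

lemma act_eq_act_cases:
  assumes "act x m = act y m'" "x \<noteq> y"
  obtains s t n where "([x, s], [y, t]) \<in> M1_rels \<union> M1_rels\<inverse>" "m = s # n" "m' = t # n"
  using assms by (auto simp: act_eq_if neq_Nil_conv M1_rels_def split: if_splits)

lemma M1_rels_nf_eq:
  assumes "(u, v) \<in> M1_rels \<union> M1_rels\<inverse>"
  shows "nf (u @ w) = nf (v @ w)"
  using assms by (auto simp: M1_rels_def)

lemma M1_rels_second_letters:
  assumes "([x, s], [y, t]) \<in> M1_rels \<union> M1_rels\<inverse>"
  shows "s \<in> {la, lb, C1, D1}" "t \<in> {la, lb, C1, D1}"
  using assms by (auto simp: M1_rels_def)


section \<open>Common right multiples of words\<close>

definition left_dvd :: "letter list \<Rightarrow> letter list \<Rightarrow> bool" where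
  "left_dvd u v \<longleftrightarrow> (\<exists>m. nf (u @ m) = nf v)"

lemma left_dvd_Nil [simp]: "left_dvd [] v"
  by (auto simp: left_dvd_def)

lemma left_dvd_append: "left_dvd u (u @ m)"
  by (auto simp: left_dvd_def)

lemma left_dvd_nf_left [simp]: "left_dvd (nf u) v \<longleftrightarrow> left_dvd u v"
  by (simp add: left_dvd_def foldr_act_cong[OF nf_pres_cong[of u], symmetric])

lemma left_dvd_nf_cong: "nf v = nf w \<Longrightarrow> left_dvd u v \<longleftrightarrow> left_dvd u w"
  by (simp add: left_dvd_def)

lemma left_dvd_Cons_iff [simp]: "left_dvd (x # u) (x # w) \<longleftrightarrow> left_dvd u w"
  by (simp add: left_dvd_def)

lemma left_dvd_Cons_D: "left_dvd (x # u) v \<Longrightarrow> \<exists>w. nf v = nf (x # w) \<and> left_dvd u w"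
  unfolding left_dvd_def by (metis append_Cons foldr_Cons comp_apply)

text \<open>An empty list \<open>rs\<close> expresses that there are no common multiples, so disjoint ideals need no
  separate treatment.\<close>

definition right_multiples_generated_by ::
    "letter list \<Rightarrow> letter list \<Rightarrow> letter list list \<Rightarrow> bool" where
  "right_multiples_generated_by p q rs \<longleftrightarrow>
    (\<forall>v. left_dvd p v \<and> left_dvd q v \<longleftrightarrow> (\<exists>r\<in>set rs. left_dvd r v))"

lemma right_multiples_generated_by_commute:
  "right_multiples_generated_by p q rs \<longleftrightarrow> right_multiples_generated_by q p rs"
  by (auto simp: right_multiples_generated_by_def)

text \<open>A common multiple of \<open>xp\<close> and \<open>xq\<close> is \<open>x\<close> times some \<open>w\<close>, and cancelling \<open>x\<close> shows that
  \<open>w\<close> is a common multiple of \<open>p\<close> and \<open>q\<close>.\<close>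

lemma right_multiples_generated_by_Cons:
  assumes "right_multiples_generated_by p q rs"
  shows "right_multiples_generated_by (x # p) (x # q) (map ((#) x) rs)"
  unfolding right_multiples_generated_by_def
proof
  fix v
  show "left_dvd (x # p) v \<and> left_dvd (x # q) v \<longleftrightarrow> (\<exists>r\<in>set (map ((#) x) rs). left_dvd r v)"
  proof (cases "\<exists>w. nf v = nf (x # w)")
    case True
    then obtain w where "nf v = nf (x # w)" by blast
    then have "left_dvd u v \<longleftrightarrow> left_dvd u (x # w)" for u
      by (rule left_dvd_nf_cong)
    then show ?thesis
      using assms by (simp add: right_multiples_generated_by_def)
  next
    case False
    then show ?thesis by (fastforce dest: left_dvd_Cons_D)
  qed
qed

lemma left_dvd_both_cases:
  assumes "left_dvd (x # p) v" "left_dvd (y # q) v" "x \<noteq> y"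
  obtains s t w where "([x, s], [y, t]) \<in> M1_rels \<union> M1_rels\<inverse>"
    "left_dvd p (s # w)" "left_dvd q (t # w)" "nf v = nf (x # s # w)"
proof -
  from assms(1,2) obtain m m' where
    m: "act x (nf (p @ m)) = nf v" and m': "act y (nf (q @ m')) = nf v"
    by (auto simp: left_dvd_def)
  from m m' have "act x (nf (p @ m)) = act y (nf (q @ m'))" by simp
  then obtain s t n where st: "([x, s], [y, t]) \<in> M1_rels \<union> M1_rels\<inverse>"
    and n: "nf (p @ m) = s # n" "nf (q @ m') = t # n"
    using \<open>x \<noteq> y\<close> by (rule act_eq_act_cases)
  have "nf (s # n) = s # n" "nf (t # n) = t # n"
    using n by (metis nf_idem)+
  with n have "nf (p @ m) = nf (s # n)" "nf (q @ m') = nf (t # n)" by simp_all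
  moreover from this m have "nf v = nf (x # s # n)" by simp
  ultimately show thesis
    using that[OF st, of n] unfolding left_dvd_def by blast
qed

text \<open>A second letter of a relation is never produced at the front by rewriting, so a nonempty word
  that divides \<open>sw\<close> begins with \<open>s\<close> itself.\<close>

lemma left_dvd_second_letter:
  assumes "left_dvd (z # p) (s # w)" "s \<in> {la, lb, C1, D1}"
  shows "z = s"
proof -
  have "act s (nf w) = s # nf w" using assms(2) by auto
  with assms show ?thesis
    by (auto simp: left_dvd_def act_eq_Cons_second_letter)
qed

lemma left_dvd_appendD: "left_dvd (u @ m) v \<Longrightarrow> left_dvd u v"
  unfolding left_dvd_def by (metis append_assoc)

lemma left_dvd_M1_rels:
  assumes "(u, v) \<in> M1_rels \<union> M1_rels\<inverse>"
  shows "left_dvd u w \<longleftrightarrow> left_dvd v w"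
  unfolding left_dvd_def using M1_rels_nf_eq[OF assms] by simp

text \<open>Each relation whose sides begin with \<open>x\<close> and \<open>y\<close> contributes one generator, and no pair of
  initial letters occurs in more than two relations.\<close>

lemma right_multiples_generated_by_letters:
  assumes "x \<noteq> y"
  shows "\<exists>rs. length rs \<le> 2 \<and> right_multiples_generated_by [x] [y] rs"
proof -
  define second where "second s \<longleftrightarrow> (\<exists>t. ([x, s], [y, t]) \<in> M1_rels \<union> M1_rels\<inverse>)" for s
  define rs where "rs = map (\<lambda>s. [x, s]) (filter second [la, lb, C1, D1])"
  have "set (filter second [la, lb, C1, D1]) = {s. second s}"
    using M1_rels_second_letters(1)[of x _ y] unfolding second_def set_filter by auto
  then have set_rs: "r \<in> set rs \<longleftrightarrow> (\<exists>s t. r = [x, s] \<and> ([x, s], [y, t]) \<in> M1_rels \<union> M1_rels\<inverse>)" for r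
    unfolding rs_def set_map second_def by blast
  have "left_dvd [x] v \<and> left_dvd [y] v" if "r \<in> set rs" "left_dvd r v" for r v
  proof -
    from that obtain s t where st: "([x, s], [y, t]) \<in> M1_rels \<union> M1_rels\<inverse>"
      and "left_dvd [x, s] v"
      unfolding set_rs by blast
    then have "left_dvd ([x] @ [s]) v" "left_dvd ([y] @ [t]) v"
      using left_dvd_M1_rels[OF st] by simp_all
    then show ?thesis by (blast dest: left_dvd_appendD)
  qed
  moreover have "\<exists>r\<in>set rs. left_dvd r v" if v: "left_dvd [x] v" "left_dvd [y] v" for v
  proof -
    obtain s t w where st: "([x, s], [y, t]) \<in> M1_rels \<union> M1_rels\<inverse>"
      and "nf v = nf ([x, s] @ w)"
      by (rule left_dvd_both_cases[OF v assms]) simp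
    then have "left_dvd [x, s] v"
      unfolding left_dvd_def by metis
    moreover have "[x, s] \<in> set rs" using st set_rs by metis
    ultimately show ?thesis by blast
  qed
  moreover have "length rs \<le> 2"
    by (cases x; cases y; simp add: rs_def second_def M1_rels_def)
  ultimately show ?thesis
    unfolding right_multiples_generated_by_def by blast
qed

text \<open>The second letter \<open>z\<close> selects at most one relation between \<open>x\<close> and \<open>y\<close>; if there is one, then
  \<open>y\<close> divides \<open>xz\<close>.\<close>

lemma right_multiples_generated_by_letter:
  assumes "x \<noteq> y"
  shows "\<exists>rs. length rs \<le> 2 \<and> right_multiples_generated_by (x # z # p) [y] rs"
proof (cases "\<exists>t. ([x, z], [y, t]) \<in> M1_rels \<union> M1_rels\<inverse>")
  case True
  then obtain t where zt: "([x, z], [y, t]) \<in> M1_rels \<union> M1_rels\<inverse>" by blast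
  have "left_dvd [y] v" if "left_dvd (x # z # p) v" for v
  proof -
    from that have "left_dvd ([x, z] @ p) v" by simp
    then have "left_dvd ([y] @ [t]) v"
      using left_dvd_M1_rels[OF zt] left_dvd_appendD by (metis append_Cons append_Nil)
    then show ?thesis by (rule left_dvd_appendD)
  qed
  then have "right_multiples_generated_by (x # z # p) [y] [x # z # p]"
    by (auto simp: right_multiples_generated_by_def)
  then show ?thesis by (intro exI[of _ "[x # z # p]"]) simp
next
  case False
  have "\<not> (left_dvd (x # z # p) v \<and> left_dvd [y] v)" for v
    using left_dvd_both_cases[OF _ _ assms, of "z # p" v "[]"] False
    by (metis M1_rels_second_letters(1) left_dvd_second_letter)
  then have "right_multiples_generated_by (x # z # p) [y] []"
    by (simp add: right_multiples_generated_by_def)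
  then show ?thesis by (intro exI[of _ "[]"]) simp
qed

lemma right_multiples_generated_by_distinct_letters:
  assumes red: "nf (x # p) = x # p" "nf (y # q) = y # q" and "x \<noteq> y"
  shows "\<exists>rs. length rs \<le> 2 \<and> right_multiples_generated_by (x # p) (y # q) rs"
proof (cases p)
  case p: Nil
  show ?thesis
  proof (cases q)
    case Nil
    with p right_multiples_generated_by_letters[OF \<open>x \<noteq> y\<close>] show ?thesis by simp
  next
    case (Cons z q')
    with p right_multiples_generated_by_letter[OF \<open>x \<noteq> y\<close>[symmetric], of z q'] show ?thesis
      by (simp add: right_multiples_generated_by_commute)
  qed
next
  case p: (Cons z p')
  show ?thesis
  proof (cases q)
    case Nil
    with p right_multiples_generated_by_letter[OF \<open>x \<noteq> y\<close>] show ?thesis by simp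
  next
    case q: (Cons z' q')
    \<comment> \<open>A common multiple would make \<open>xz = yz'\<close> a relation, but one side of any relation is a redex
      and both words are reduced.\<close>
    have "([x, z], [y, z']) \<notin> M1_rels \<union> M1_rels\<inverse>"
      using red p q by (auto simp: M1_rels_def)
    then have "\<not> (left_dvd (x # p) v \<and> left_dvd (y # q) v)" for v
      using left_dvd_both_cases[OF _ _ \<open>x \<noteq> y\<close>, of p v q] p q
      by (metis M1_rels_second_letters left_dvd_second_letter)
    then have "right_multiples_generated_by (x # p) (y # q) []"
      by (simp add: right_multiples_generated_by_def)
    then show ?thesis by (intro exI[of _ "[]"]) simp
  qed
qed

text \<open>Common prefixes are removed letter by letter. Reducedness of both words is inherited by their
  tails; it rules out common multiples of words with distinct initial letters and at least two letters
  each.\<close>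

lemma reduced_right_multiples_generated_by:
  assumes "nf p = p" "nf q = q"
  shows "\<exists>rs. length rs \<le> 2 \<and> right_multiples_generated_by p q rs"
  using assms
proof (induction p q rule: list_induct2')
  case (4 x p y q)
  show ?case
  proof (cases "x = y")
    case True
    from 4 obtain rs where "length rs \<le> 2" "right_multiples_generated_by p q rs"
      using nf_eq_ConsD by metis
    then show ?thesis
      using True by (intro exI[of _ "map ((#) x) rs"]) (simp add: right_multiples_generated_by_Cons)
  next
    case False
    with 4 show ?thesis by (intro right_multiples_generated_by_distinct_letters)
  qed
next
  case 1
  show ?case by (intro exI[of _ "[[]]"]) (simp add: right_multiples_generated_by_def)
next
  case (2 x p)
  show ?case by (intro exI[of _ "[x # p]"]) (simp add: right_multiples_generated_by_def)
next
  case (3 y q)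
  show ?case by (intro exI[of _ "[y # q]"]) (simp add: right_multiples_generated_by_def)
qed

lemma ex_right_multiples_generated_by:
  "\<exists>rs. length rs \<le> 2 \<and> right_multiples_generated_by p q rs"
  using reduced_right_multiples_generated_by[of "nf p" "nf q"]
  by (simp add: right_multiples_generated_by_def)

text \<open>A single generator of the common right multiples of \<open>d\<close> and \<open>A\<^sub>1\<close> would be a word of
  length at least 2, hence would equal both of the common multiples \<open>db\<close> and \<open>A\<^sub>1C\<^sub>1\<close>.\<close>

lemma not_right_multiples_generated_by_singleton:
  "\<not> right_multiples_generated_by [ld] [A1] [r]"
proof
  assume "right_multiples_generated_by [ld] [A1] [r]"
  then have r: "left_dvd [ld] v \<and> left_dvd [A1] v \<longleftrightarrow> left_dvd r v" for v
    by (simp add: right_multiples_generated_by_def)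
  have "left_dvd [ld] [ld, lb]" "left_dvd [ld] [A1, C1]" "left_dvd [A1] [ld, lb]" "left_dvd [A1] [A1, C1]"
    unfolding left_dvd_def by (auto intro: exI[of _ "[la]"] exI[of _ "[lb]"] exI[of _ "[C1]"] exI[of _ "[D1]"])
  with r have "left_dvd r [ld, lb]" "left_dvd r [A1, C1]" by blast+
  then obtain m m' where m: "nf (r @ m) = [ld, lb]" and m': "nf (r @ m') = [A1, C1]"
    unfolding left_dvd_def by auto
  have "left_dvd [ld] r" "left_dvd [A1] r"
    using r[of r] left_dvd_append[of r "[]"] by simp_all
  then obtain s w where "nf r = nf (ld # s # w)"
    by (rule left_dvd_both_cases) auto
  then have "2 \<le> length r"
    by (metis length_nf length_Cons Suc_le_mono le0 numeral_2_eq_2)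
  moreover have "length (r @ m) = 2" "length (r @ m') = 2"
    using m m' by (metis length_nf length_Cons list.size(3) numeral_2_eq_2)+
  ultimately have "m = []" "m' = []"
    unfolding length_append by (metis add_le_same_cancel1 le_zero_eq length_0_conv)+
  with m m' show False by simp
qed


section \<open>Principal right ideals of \<open>\<M>\<^sub>1\<close>\<close>

definition M1_of_word :: "letter list \<Rightarrow> letter list set" where
  "M1_of_word w = pres_cong M1_rels `` {w}"

lemma monoid_M1_eq: "monoid_M1 = presented_monoid M1_rels"
  by (simp add: monoid_M1_def M1_rels_def)

lemma carrier_monoid_M1: "carrier monoid_M1 = range M1_of_word"
  by (auto simp: monoid_M1_eq carrier_presented_monoid M1_of_word_def quotient_def)

lemma mult_M1_of_word: "M1_of_word u \<otimes>\<^bsub>monoid_M1\<^esub> M1_of_word v = M1_of_word (u @ v)"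
  by (simp add: monoid_M1_eq M1_of_word_def mult_presented_monoid)

lemma M1_of_word_eq_iff: "M1_of_word u = M1_of_word v \<longleftrightarrow> nf u = nf v"
  unfolding M1_of_word_def
  by (simp add: eq_equiv_class_iff[OF equiv_pres_cong] pres_cong_iff_nf_eq)

lemma M1_of_word_in_right_ideal_iff:
  "M1_of_word v \<in> M1_of_word u <#\<^bsub>monoid_M1\<^esub> carrier monoid_M1 \<longleftrightarrow> left_dvd u v"
  by (auto simp: l_coset_def carrier_monoid_M1 mult_M1_of_word M1_of_word_eq_iff left_dvd_def
      eq_commute[of "nf v"])

lemma right_ideal_subset:
  "M1_of_word u <#\<^bsub>monoid_M1\<^esub> carrier monoid_M1 \<subseteq> range M1_of_word"
  by (auto simp: l_coset_def carrier_monoid_M1 mult_M1_of_word)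

lemma set_mult_eq_Union_right_ideals:
  "M1_of_word ` R <#>\<^bsub>monoid_M1\<^esub> carrier monoid_M1 =
    (\<Union>r\<in>R. M1_of_word r <#\<^bsub>monoid_M1\<^esub> carrier monoid_M1)"
  by (auto simp: l_coset_def set_mult_def)

lemma right_ideal_inter_eq_iff:
  "(M1_of_word p <#\<^bsub>monoid_M1\<^esub> carrier monoid_M1) \<inter> (M1_of_word q <#\<^bsub>monoid_M1\<^esub> carrier monoid_M1) =
      M1_of_word ` set rs <#>\<^bsub>monoid_M1\<^esub> carrier monoid_M1 \<longleftrightarrow>
    right_multiples_generated_by p q rs"
  (is "?L = ?R \<longleftrightarrow> _")
proof -
  have "?L \<subseteq> range M1_of_word" "?R \<subseteq> range M1_of_word"
    unfolding set_mult_eq_Union_right_ideals using right_ideal_subset by (blast, blast)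
  then have "?L = ?R \<longleftrightarrow> (\<forall>v. M1_of_word v \<in> ?L \<longleftrightarrow> M1_of_word v \<in> ?R)"
    by blast
  then show ?thesis
    by (simp add: set_mult_eq_Union_right_ideals M1_of_word_in_right_ideal_iff
        right_multiples_generated_by_def)
qed

lemma left_cancellative_monoid_M1: "left_cancellative_monoid monoid_M1"
proof (intro left_cancellative_monoid.intro left_cancellative_monoid_axioms.intro)
  show "monoid monoid_M1"
    unfolding monoid_M1_eq by (rule monoid_presented_monoid)
  fix x y z
  assume "x \<in> carrier monoid_M1" "y \<in> carrier monoid_M1" "z \<in> carrier monoid_M1"
    and "x \<otimes>\<^bsub>monoid_M1\<^esub> y = x \<otimes>\<^bsub>monoid_M1\<^esub> z"
  then show "y = z"
    unfolding carrier_monoid_M1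
    by (elim rangeE) (simp add: mult_M1_of_word M1_of_word_eq_iff nf_left_cancel del: foldr_append)
qed

theorem theorem5p2: "k_aligned 2 monoid_M1 \<and> \<not> singly_aligned monoid_M1"
proof
  let ?ideal = "\<lambda>p. p <#\<^bsub>monoid_M1\<^esub> carrier monoid_M1"
  have "?ideal p \<inter> ?ideal q = {} \<or>
      (\<exists>rs. 1 \<le> length rs \<and> length rs \<le> 2 \<and> set rs \<subseteq> carrier monoid_M1 \<and>
        ?ideal p \<inter> ?ideal q = set rs <#>\<^bsub>monoid_M1\<^esub> carrier monoid_M1)"
    if "p \<in> carrier monoid_M1" "q \<in> carrier monoid_M1" for p q
  proof -
    from that obtain u v where uv: "p = M1_of_word u" "q = M1_of_word v"
      by (auto simp: carrier_monoid_M1)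
    obtain rs where "length rs \<le> 2" and rs: "right_multiples_generated_by u v rs"
      using ex_right_multiples_generated_by by blast
    then have inter: "?ideal p \<inter> ?ideal q = set (map M1_of_word rs) <#>\<^bsub>monoid_M1\<^esub> carrier monoid_M1"
      unfolding uv list.set_map right_ideal_inter_eq_iff by blast
    show ?thesis
    proof (cases "rs = []")
      case True
      with inter show ?thesis by (simp add: set_mult_def)
    next
      case False
      then have "1 \<le> length (map M1_of_word rs)" by (cases rs) auto
      moreover have "set (map M1_of_word rs) \<subseteq> carrier monoid_M1"
        by (auto simp: carrier_monoid_M1)
      ultimately show ?thesis
        using inter \<open>length rs \<le> 2\<close> by (metis length_map)
    qed
  qed
  then show "k_aligned 2 monoid_M1"
    unfolding k_aligned_def using left_cancellative_monoid_M1 by blast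
next
  let ?ideal = "\<lambda>w. M1_of_word w <#\<^bsub>monoid_M1\<^esub> carrier monoid_M1"
  show "\<not> singly_aligned monoid_M1"
  proof
    assume "singly_aligned monoid_M1"
    then have "?ideal [ld] \<inter> ?ideal [A1] = {} \<or>
        (\<exists>rs. 1 \<le> length rs \<and> length rs \<le> 1 \<and> set rs \<subseteq> carrier monoid_M1 \<and>
          ?ideal [ld] \<inter> ?ideal [A1] = set rs <#>\<^bsub>monoid_M1\<^esub> carrier monoid_M1)"
      unfolding k_aligned_def by (auto simp: carrier_monoid_M1)
    moreover have "M1_of_word [ld, la] \<in> ?ideal [ld] \<inter> ?ideal [A1]"
      unfolding Int_iff M1_of_word_in_right_ideal_iff left_dvd_def
      by (auto intro: exI[of _ "[la]"] exI[of _ "[C1]"])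
    ultimately obtain rs where "length rs = 1" "set rs \<subseteq> range M1_of_word"
      and inter: "?ideal [ld] \<inter> ?ideal [A1] = set rs <#>\<^bsub>monoid_M1\<^esub> carrier monoid_M1"
      by (auto simp: carrier_monoid_M1)
    then obtain r where "rs = [M1_of_word r]"
      by (auto simp: length_Suc_conv)
    with inter have "right_multiples_generated_by [ld] [A1] [r]"
      using right_ideal_inter_eq_iff[of "[ld]" "[A1]" "[r]"] by simp
    then show False
      by (simp add: not_right_multiples_generated_by_singleton)
  qed
qed

end
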